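(* For any $\mathbf{k},\alpha\in\mathbb{N}^n$, one has $$L_\alpha^{[\mathbf{k}]}(\xi z)=\frac{(-1)^{|\alpha|}}{\alpha!}\,\xi^{-\mathbf{k}}\big(\xi^{\alpha+\mathbf{k}}\ast z^\alpha\big),\qquad L_\alpha^{[\mathbf{k}]}(\xi z)=\frac{(-1)^{|\alpha|}}{\alpha!}\,z^{-\mathbf{k}}\big(\xi^\alpha\ast z^{\alpha+\mathbf{k}}\big),$$ where $\xi z:=(\xi_1z_1,\xi_2z_2,\dots,\xi_nz_n)$. In particular, for the Laguerre polynomials $L_\alpha:=L_\alpha^{[0]}$, $$L_\alpha(\xi z)=\frac{(-1)^{|\alpha|}}{\alpha!}\,\xi^\alpha\ast z^\alpha .$$
   Context: Let $\xi=(\xi_1,\dots,\xi_n)$ and $z=(z_1,\dots,z_n)$ be $2n$ commuting free variables, $\partial_i=\partial/\partial z_i$, $\delta_i=\partial/\partial\xi_i$. The product $\ast$ on the vector space $\mathbb{C}[\xi,z]$ is $f\ast g:=\mu\big(e^{-\Omega}(f\otimes g)\big)$, where $\Omega=\sum_{i=1}^n(\partial_i\otimes\delta_i+\delta_i\otimes\partial_i)$ and $\mu(f\otimes g)=fg$ is the usual multiplication. The multiplications by $\xi^{-\mathbf{k}}$, $z^{-\mathbf{k}}$ are the usual ones (of Laurent polynomials). For $k,m\in\mathbb{N}$ the one-variable generalized Laguerre polynomial is $L_m^{[k]}(x)=\sum_{j=0}^m\binom{m+k}{m-j}\frac{(-x)^j}{j!}$; for $\mathbf{k}=(k_1,\dots,k_n)$,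 $\alpha=(a_1,\dots,a_n)\in\mathbb{N}^n$, $L_\alpha^{[\mathbf{k}]}(z):=L_{a_1}^{[k_1]}(z_1)\cdots L_{a_n}^{[k_n]}(z_n)$. Also $|\alpha|=\sum a_i$, $\alpha!=\prod a_i!$. *)

theory Defs
  imports Complex_Main
    "HOL-Library.Poly_Mapping"
    "HOL-Library.Product_Plus"
    "HOL-Computational_Algebra.Polynomial"
begin

section \<open>The polynomial ring in the variables $\xi$ and $z$, and its Laurent polynomials\<close>

text \<open>
  The $2n$ variables $\xi_i$, $z_i$ are indexed by a finite type \<open>'n\<close> with $n$ elements.
  Polynomials, Laurent polynomials and elements of the tensor square of the polynomial ring are all
  finitely supported complex functions on the respective monoid of exponents; their ring structure
  is the convolution product of \<open>Poly_Mapping\<close>.  For the tensor square this uses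
  $\mathbb{C}[M] \otimes \mathbb{C}[M] = \mathbb{C}[M \times M]$, the pair \<open>(a, b)\<close> standing
  for the basis tensor of the monomials with exponents \<open>a\<close> and \<open>b\<close>.
\<close>

datatype 'n var = Xi 'n | Zv 'n

type_synonym 'n cpoly = "('n var \<Rightarrow>\<^sub>0 nat) \<Rightarrow>\<^sub>0 complex"
type_synonym 'n laurent = "('n var \<Rightarrow>\<^sub>0 int) \<Rightarrow>\<^sub>0 complex"
type_synonym 'n tensor_sq = "(('n var \<Rightarrow>\<^sub>0 nat) \<times> ('n var \<Rightarrow>\<^sub>0 nat)) \<Rightarrow>\<^sub>0 complex"

definition scale :: "complex \<Rightarrow> ('a \<Rightarrow>\<^sub>0 complex) \<Rightarrow> ('a \<Rightarrow>\<^sub>0 complex)" where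
  "scale c p = Poly_Mapping.map ((*) c) p"

text \<open>The linear map with prescribed values \<open>F\<close> on the monomial basis.\<close>

definition lin_ext :: "('a \<Rightarrow> ('b \<Rightarrow>\<^sub>0 complex)) \<Rightarrow> ('a \<Rightarrow>\<^sub>0 complex) \<Rightarrow> ('b \<Rightarrow>\<^sub>0 complex)" where
  "lin_ext F p = (\<Sum>m\<in>Poly_Mapping.keys p. scale (Poly_Mapping.lookup p m) (F m))"

definition indet :: "'n var \<Rightarrow> 'n cpoly" where
  "indet v = Poly_Mapping.single (Poly_Mapping.single v 1) 1"

text \<open>\<open>var_power Xi a\<close> is $\xi^a$ and \<open>var_power Zv a\<close> is $z^a$.\<close>

definition var_power :: "('n \<Rightarrow> 'n var) \<Rightarrow> ('n::finite \<Rightarrow> nat) \<Rightarrow> 'n cpoly" where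
  "var_power v a = (\<Prod>i\<in>UNIV. indet (v i) ^ a i)"

definition to_laurent :: "'n cpoly \<Rightarrow> 'n laurent" where
  "to_laurent = lin_ext (\<lambda>m. Poly_Mapping.single (Poly_Mapping.map int m) 1)"

definition laurent_monom :: "('n \<Rightarrow> 'n var) \<Rightarrow> ('n::finite \<Rightarrow> int) \<Rightarrow> 'n laurent" where
  "laurent_monom v e = Poly_Mapping.single (\<Sum>i\<in>UNIV. Poly_Mapping.single (v i) (e i)) 1"


section \<open>The product $\ast$\<close>

text \<open>
  The subtraction of exponents is truncated, but its value is irrelevant whenever the exponent of
  \<open>v\<close> is \<open>0\<close>, since then the coefficient vanishes.
\<close>

definition partial :: "'n var \<Rightarrow> 'n cpoly \<Rightarrow> 'n cpoly" where
  "partial v = lin_ext (\<lambda>m. Poly_Mapping.single (m - Poly_Mapping.single v 1)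
                                (of_nat (Poly_Mapping.lookup m v)))"

definition tensor :: "'n cpoly \<Rightarrow> 'n cpoly \<Rightarrow> 'n tensor_sq" where
  "tensor f g = lin_ext (\<lambda>a. lin_ext (\<lambda>b. Poly_Mapping.single (a, b) 1) g) f"

text \<open>The linear operator $D \otimes E$ on the tensor square, for linear \<open>D\<close> and \<open>E\<close>.\<close>

definition tensor_map ::
  "('n cpoly \<Rightarrow> 'n cpoly) \<Rightarrow> ('n cpoly \<Rightarrow> 'n cpoly) \<Rightarrow> 'n tensor_sq \<Rightarrow> 'n tensor_sq" where
  "tensor_map D E =
     lin_ext (\<lambda>(a, b). tensor (D (Poly_Mapping.single a 1)) (E (Poly_Mapping.single b 1)))"

definition mu :: "'n tensor_sq \<Rightarrow> 'n cpoly" where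
  "mu = lin_ext (\<lambda>(a, b). Poly_Mapping.single (a + b) 1)"

definition Omega :: "'n::finite tensor_sq \<Rightarrow> 'n tensor_sq" where
  "Omega t = (\<Sum>i\<in>UNIV. tensor_map (partial (Zv i)) (partial (Xi i)) t
                       + tensor_map (partial (Xi i)) (partial (Zv i)) t)"

text \<open>
  The exponential of a locally nilpotent operator; \<open>Sum_any\<close> sums over the (finite) support.
  That $-\Omega$ is locally nilpotent is shown below.
\<close>

definition op_exp :: "(('a \<Rightarrow>\<^sub>0 complex) \<Rightarrow> ('a \<Rightarrow>\<^sub>0 complex)) \<Rightarrow> ('a \<Rightarrow>\<^sub>0 complex) \<Rightarrow> ('a \<Rightarrow>\<^sub>0 complex)" where
  "op_exp T t = Sum_any (\<lambda>k::nat. scale (1 / fact k) ((T ^^ k) t))"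

definition star_prod :: "'n::finite cpoly \<Rightarrow> 'n cpoly \<Rightarrow> 'n cpoly" (infixl \<open>\<star>\<close> 70) where
  "f \<star> g = mu (op_exp (\<lambda>t. - Omega t) (tensor f g))"


section \<open>Generalized Laguerre polynomials\<close>

definition laguerre :: "nat \<Rightarrow> nat \<Rightarrow> complex poly" where
  "laguerre k m = (\<Sum>j\<le>m. smult (of_nat ((m + k) choose (m - j)) / fact j) ([:0, -1:] ^ j))"

text \<open>
  $L_\alpha^{[\mathbf{k}]}(x_1, \dots, x_n)$ at polynomials $x_i$; the coefficients are embedded as
  constant polynomials.
\<close>

definition mlaguerre :: "('n::finite \<Rightarrow> nat) \<Rightarrow> ('n \<Rightarrow> nat) \<Rightarrow> ('n \<Rightarrow> 'n cpoly) \<Rightarrow> 'n cpoly" where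
  "mlaguerre k \<alpha> x =
     (\<Prod>i\<in>UNIV. poly (map_poly (Poly_Mapping.single 0) (laguerre (k i) (\<alpha> i))) (x i))"

abbreviation mlaguerre0 :: "('n::finite \<Rightarrow> nat) \<Rightarrow> ('n \<Rightarrow> 'n cpoly) \<Rightarrow> 'n cpoly" where
  "mlaguerre0 \<equiv> mlaguerre (\<lambda>_. 0)"

text \<open>$|\alpha|$ and $\alpha!$\<close>

definition multi_size :: "('n::finite \<Rightarrow> nat) \<Rightarrow> nat" where
  "multi_size \<alpha> = (\<Sum>i\<in>UNIV. \<alpha> i)"

definition multi_fact :: "('n::finite \<Rightarrow> nat) \<Rightarrow> complex" where
  "multi_fact \<alpha> = (\<Prod>i\<in>UNIV. fact (\<alpha> i))"


section \<open>Basic properties of the definitions\<close>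

lemma lookup_scale [simp]:
  "Poly_Mapping.lookup (scale c p) m = c * Poly_Mapping.lookup p m"
  by (simp add: scale_def Poly_Mapping.map.rep_eq when_def)

lemma scale_simps [simp]: "scale 0 p = 0" "scale c 0 = 0" "scale 1 p = p"
  by (auto intro: poly_mapping_eqI)

lemma scale_add: "scale (c + d) p = scale c p + scale d p"
  by (rule poly_mapping_eqI) (simp add: lookup_add algebra_simps)

lemma scale_scale: "scale c (scale d p) = scale (c * d) p"
  by (rule poly_mapping_eqI) simp

lemma scale_sum: "scale c (\<Sum>x\<in>A. f x) = (\<Sum>x\<in>A. scale c (f x))"
  by (rule poly_mapping_eqI) (simp add: lookup_sum sum_distrib_left)

lemma scale_single: "scale c (Poly_Mapping.single m d) = Poly_Mapping.single m (c * d)"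
  by (rule poly_mapping_eqI) (simp add: lookup_single when_def)

lemma lin_ext_superset:
  assumes "finite S" "Poly_Mapping.keys p \<subseteq> S"
  shows "lin_ext F p = (\<Sum>m\<in>S. scale (Poly_Mapping.lookup p m) (F m))"
  unfolding lin_ext_def
  by (rule sum.mono_neutral_left) (use assms in \<open>auto simp: in_keys_iff\<close>)

lemma lin_ext_zero [simp]: "lin_ext F 0 = 0"
  by (simp add: lin_ext_def)

lemma lin_ext_add: "lin_ext F (p + q) = lin_ext F p + lin_ext F q"
proof -
  let ?S = "Poly_Mapping.keys p \<union> Poly_Mapping.keys q"
  have "Poly_Mapping.keys (p + q) \<subseteq> ?S" by (rule keys_add)
  then show ?thesis
    by (simp add: lin_ext_superset[of ?S] lookup_add scale_add sum.distrib)
qed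

lemma lin_ext_scale: "lin_ext F (scale c p) = scale c (lin_ext F p)"
proof -
  have "Poly_Mapping.keys (scale c p) \<subseteq> Poly_Mapping.keys p" by (auto simp: in_keys_iff)
  then show ?thesis
    by (simp add: lin_ext_superset[of "Poly_Mapping.keys p"] scale_sum scale_scale)
qed

lemma lin_ext_sum: "lin_ext F (\<Sum>x\<in>A. f x) = (\<Sum>x\<in>A. lin_ext F (f x))"
  by (induction A rule: infinite_finite_induct) (auto simp: lin_ext_add)

lemma lin_ext_single [simp]: "lin_ext F (Poly_Mapping.single m c) = scale c (F m)"
  by (simp add: lin_ext_superset[of "{m}"])

lemma lin_ext_lin_ext: "lin_ext F (lin_ext G p) = lin_ext (\<lambda>m. lin_ext F (G m)) p"
  unfolding lin_ext_def[of G] lin_ext_def[of "\<lambda>m. lin_ext F (G m)"]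
  by (simp add: lin_ext_sum lin_ext_scale)

lemma lin_ext_id: "lin_ext (\<lambda>m. Poly_Mapping.single m 1) p = p"
  by (rule poly_mapping_eqI)
    (auto simp: lin_ext_def lookup_sum lookup_single when_def in_keys_iff
      if_distrib sum.delta cong: if_cong)

lemma tensor_single [simp]:
  "tensor (Poly_Mapping.single a c) (Poly_Mapping.single b d) = Poly_Mapping.single (a, b) (c * d)"
  by (simp add: tensor_def scale_single)

lemma lookup_tensor:
  "Poly_Mapping.lookup (tensor f g) (a, b) = Poly_Mapping.lookup f a * Poly_Mapping.lookup g b"
proof -
  have *: "Poly_Mapping.lookup (lin_ext (\<lambda>b'. Poly_Mapping.single (x, b') 1) g) (a, b)
        = (if x = a then Poly_Mapping.lookup g b else 0)" for x
    by (auto simp: lin_ext_def lookup_sum lookup_single when_def in_keys_iff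
        if_distrib sum.delta cong: if_cong)
  show ?thesis
    by (simp add: tensor_def lin_ext_def[of _ f] lookup_sum * if_distrib sum.delta
        in_keys_iff cong: if_cong)
qed

lemma lookup_partial:
  "Poly_Mapping.lookup (partial v p) m =
     of_nat (Poly_Mapping.lookup m v + 1) * Poly_Mapping.lookup p (m + Poly_Mapping.single v 1)"
proof -
  have *: "scale (Poly_Mapping.lookup p x)
            (Poly_Mapping.single (x - Poly_Mapping.single v 1) (of_nat (Poly_Mapping.lookup x v)))
        = Poly_Mapping.single (x - Poly_Mapping.single v 1)
            (Poly_Mapping.lookup p x * of_nat (Poly_Mapping.lookup x v))" for x
    by (simp add: scale_single)
  have **: "(x - Poly_Mapping.single v 1 = m \<and> Poly_Mapping.lookup x v \<noteq> 0)
        \<longleftrightarrow> x = m + Poly_Mapping.single v 1" for x :: "'a var \<Rightarrow>\<^sub>0 nat"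
    by (auto simp: poly_mapping_eq_iff fun_eq_iff lookup_add lookup_minus lookup_single when_def)
  have "Poly_Mapping.lookup (partial v p) m = (\<Sum>x\<in>Poly_Mapping.keys p.
          if x = m + Poly_Mapping.single v 1
          then Poly_Mapping.lookup p x * of_nat (Poly_Mapping.lookup x v) else 0)"
    unfolding partial_def lin_ext_def lookup_sum *
    by (intro sum.cong refl) (use ** in \<open>auto simp: lookup_single when_def\<close>)
  also have "\<dots> = (if m + Poly_Mapping.single v 1 \<in> Poly_Mapping.keys p
      then Poly_Mapping.lookup p (m + Poly_Mapping.single v 1)
           * of_nat (Poly_Mapping.lookup (m + Poly_Mapping.single v 1) v) else 0)"
    by (simp add: sum.delta)
  finally show ?thesis by (auto simp: in_keys_iff lookup_add)
qed

lemma tensor_eq_sum: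
  "tensor f g = (\<Sum>a\<in>Poly_Mapping.keys f. \<Sum>b\<in>Poly_Mapping.keys g.
     Poly_Mapping.single (a, b) (Poly_Mapping.lookup f a * Poly_Mapping.lookup g b))"
  by (simp add: tensor_def lin_ext_def scale_sum scale_single)

lemma tensor_sum_scale:
  "tensor (\<Sum>x\<in>A. scale (c x) (f x)) (\<Sum>y\<in>B. scale (d y) (g y))
     = (\<Sum>x\<in>A. \<Sum>y\<in>B. scale (c x * d y) (tensor (f x) (g y)))"
  by (rule poly_mapping_eqI, rename_tac m, case_tac m)
    (simp add: lookup_tensor lookup_sum sum_product mult_ac)

lemma tensor_map_tensor:
  "tensor_map (lin_ext F) (lin_ext G) (tensor f g) = tensor (lin_ext F f) (lin_ext G g)"
proof -
  have "tensor (lin_ext F f) (lin_ext G g) =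
     (\<Sum>a\<in>Poly_Mapping.keys f. \<Sum>b\<in>Poly_Mapping.keys g.
        scale (Poly_Mapping.lookup f a * Poly_Mapping.lookup g b) (tensor (F a) (G b)))"
    by (simp add: lin_ext_def tensor_sum_scale)
  then show ?thesis
    by (simp add: tensor_map_def tensor_eq_sum[of f g] lin_ext_sum)
qed

lemma mu_tensor: "mu (tensor f g) = f * g"
proof -
  have "mu (tensor f g) = (\<Sum>a\<in>Poly_Mapping.keys f. \<Sum>b\<in>Poly_Mapping.keys g.
      Poly_Mapping.single a (Poly_Mapping.lookup f a) * Poly_Mapping.single b (Poly_Mapping.lookup g b))"
    by (simp add: mu_def tensor_eq_sum lin_ext_sum scale_single mult_single)
  also have "\<dots> = lin_ext (\<lambda>m. Poly_Mapping.single m 1) f * lin_ext (\<lambda>m. Poly_Mapping.single m 1) g"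
    by (simp add: lin_ext_def scale_single sum_product)
  finally show ?thesis by (simp add: lin_ext_id)
qed

lemma to_laurent_single:
  "to_laurent (Poly_Mapping.single m c) = Poly_Mapping.single (Poly_Mapping.map int m) c"
  by (simp add: to_laurent_def scale_single)


subsection \<open>Local nilpotency of $\Omega$\<close>

definition total_deg :: "('n::finite var \<Rightarrow>\<^sub>0 nat) \<Rightarrow> nat" where
  "total_deg m = (\<Sum>i\<in>UNIV. Poly_Mapping.lookup m (Xi i)) + (\<Sum>i\<in>UNIV. Poly_Mapping.lookup m (Zv i))"

lemma total_deg_add: "total_deg (a + b) = total_deg a + total_deg b"
  by (simp add: total_deg_def lookup_add sum.distrib)

lemma total_deg_single [simp]: "total_deg (Poly_Mapping.single v c) = c"
  by (cases v) (simp_all add: total_deg_def lookup_single when_def)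

lemma keys_partial:
  "m \<in> Poly_Mapping.keys (partial v p) \<Longrightarrow> m + Poly_Mapping.single v 1 \<in> Poly_Mapping.keys p"
  by (auto simp: in_keys_iff lookup_partial)

lemma keys_sum_subset: "Poly_Mapping.keys (\<Sum>x\<in>A. f x) \<subseteq> (\<Union>x\<in>A. Poly_Mapping.keys (f x))"
  by (rule subsetI, unfold UN_iff in_keys_iff lookup_sum) (rule ccontr, simp)

lemma keys_tensor_map_partial:
  fixes t :: "'n::finite tensor_sq"
  assumes "(a, b) \<in> Poly_Mapping.keys (tensor_map (partial v) (partial w) t)"
  shows "(a + Poly_Mapping.single v 1, b + Poly_Mapping.single w 1) \<in> Poly_Mapping.keys t"
proof -
  let ?F = "\<lambda>(a', b'). tensor (partial v (Poly_Mapping.single a' 1)) (partial w (Poly_Mapping.single b' 1))"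
  obtain x where x: "x \<in> Poly_Mapping.keys t"
    "(a, b) \<in> Poly_Mapping.keys (scale (Poly_Mapping.lookup t x) (?F x))"
    using subsetD[OF keys_sum_subset assms[unfolded tensor_map_def lin_ext_def]] by (elim UN_E)
  obtain a' b' where ab: "x = (a', b')" by (cases x)
  from x(2) have "a \<in> Poly_Mapping.keys (partial v (Poly_Mapping.single a' 1))"
    "b \<in> Poly_Mapping.keys (partial w (Poly_Mapping.single b' 1))"
    by (auto simp: ab in_keys_iff lookup_tensor)
  then have "a + Poly_Mapping.single v 1 = a'" "b + Poly_Mapping.single w 1 = b'"
    by (auto dest!: keys_partial)
  with x(1) ab show ?thesis by simp
qed

lemma keys_Omega:
  fixes t :: "'n::finite tensor_sq"
  assumes "(a, b) \<in> Poly_Mapping.keys (Omega t)"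
  shows "\<exists>a' b'. (a', b') \<in> Poly_Mapping.keys t \<and> total_deg a' = Suc (total_deg a)"
proof -
  obtain i where "(a, b) \<in> Poly_Mapping.keys (tensor_map (partial (Zv i)) (partial (Xi i)) t
                       + tensor_map (partial (Xi i)) (partial (Zv i)) t)"
    using subsetD[OF keys_sum_subset assms[unfolded Omega_def]] by (elim UN_E)
  then have "(a, b) \<in> Poly_Mapping.keys (tensor_map (partial (Zv i)) (partial (Xi i)) t) \<or>
    (a, b) \<in> Poly_Mapping.keys (tensor_map (partial (Xi i)) (partial (Zv i)) t)"
    by (rule subsetD[OF keys_add, unfolded Un_iff])
  then have "\<exists>v w. (a + Poly_Mapping.single v 1, b + Poly_Mapping.single w 1) \<in> Poly_Mapping.keys t"
    by (elim disjE) (intro exI, erule keys_tensor_map_partial)+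
  then obtain v w where
    "(a + Poly_Mapping.single v 1, b + Poly_Mapping.single w 1) \<in> Poly_Mapping.keys t"
    by (elim exE)
  then show ?thesis
    by (intro exI conjI) (assumption, simp add: total_deg_add)
qed

lemma Omega_locally_nilpotent:
  fixes t :: "'n::finite tensor_sq"
  shows "finite {k. ((\<lambda>t. - Omega t) ^^ k) t \<noteq> 0}"
proof -
  let ?T = "\<lambda>t. - Omega t"
  define N where "N = Max (insert 0 ((\<lambda>x. total_deg (fst x)) ` Poly_Mapping.keys t))"
  have N: "total_deg a \<le> N" if "(a, b) \<in> Poly_Mapping.keys t" for a b
    unfolding N_def using that by (intro Max_ge) force+
  have step: "\<forall>a b. (a, b) \<in> Poly_Mapping.keys ((?T ^^ k) t) \<longrightarrow> total_deg a + k \<le> N" for k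
  proof (induction k)
    case 0
    then show ?case using N by auto
  next
    case (Suc k)
    have "total_deg a + Suc k \<le> N" if "(a, b) \<in> Poly_Mapping.keys ((?T ^^ Suc k) t)" for a b
    proof -
      from that have "(a, b) \<in> Poly_Mapping.keys (Omega ((?T ^^ k) t))"
        by (simp add: in_keys_iff)
      then obtain a' b' where "(a', b') \<in> Poly_Mapping.keys ((?T ^^ k) t)"
        "total_deg a' = Suc (total_deg a)" using keys_Omega by blast
      with Suc.IH show ?thesis by fastforce
    qed
    then show ?case by blast
  qed
  have "(?T ^^ k) t = 0" if "k > N" for k
  proof (rule poly_mapping_eqI)
    fix m :: "('n var \<Rightarrow>\<^sub>0 nat) \<times> ('n var \<Rightarrow>\<^sub>0 nat)"
    obtain a b where "m = (a, b)" by (cases m)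
    then show "Poly_Mapping.lookup ((?T ^^ k) t) m = Poly_Mapping.lookup 0 m"
      using step[of k] that by (force simp: in_keys_iff)
  qed
  then show ?thesis
    by (intro finite_subset[OF _ finite_atMost[of N]] subsetI, unfold mem_Collect_eq atMost_iff)
      (rule ccontr, unfold not_le, rule notE)
qed

end

theory Submission
  imports Defs "HOL-Library.FuncSet"
begin

text \<open>
  The operator $\Omega$ sends $\xi^a \otimes z^b$ to
  $\sum_i a_i b_i\, \xi^{a - e_i} \otimes z^{b - e_i}$: the summands $\partial_i \otimes \delta_i$
  kill it, and each $\delta_i \otimes \partial_i$ removes one factor $\xi_i$ on the left and one
  factor $z_i$ on the right.  For a multi-index $j$, the tensor
  \[
    v_j = \Bigl(\prod_i j_i! \binom{a_i}{j_i} \binom{b_i}{j_i}\Bigr)\, \xi^{a - j} \otimes z^{b - j}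
  \]
  is the one obtained by performing $j_i$ such contractions in the $i$-th pair of variables, divided
  by $j!$.  In this normalization the $v_j$ behave like divided powers:
  $\Omega v_j = \sum_i (j_i + 1)\, v_{j + e_i}$ (\<open>Omega_contraction\<close>).  Summing over all $j$ of
  size $n$, each $v_{j'}$ of size $n + 1$ is reached with total weight
  $\sum_i j'_i = n + 1$, so $\Omega^n / n!$ maps $v_0 = \xi^a \otimes z^b$ to
  $\sum_{|j| = n} v_j$ (\<open>Omega_contraction_sum\<close>).  Hence
  \[
    \xi^a \ast z^b = \sum_j (-1)^{|j|} \prod_i j_i! \binom{a_i}{j_i} \binom{b_i}{j_i}\,
      \xi_i^{a_i - j_i} z_i^{b_i - j_i},
  \]
  and this sum over multi-indices factors as a product over $i$ (\<open>star_xi_z\<close>).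

  Everything is thereby reduced to one pair of variables $x, y$, where for
  $a = m + k$, $b = m$ the substitution $j = m - l$ turns the sum over $l$ into
  $(-1)^m\, m!\, x^k L_m^{[k]}(xy)$ (\<open>laguerre_one_variable\<close>).  The product over $i$
  of these identities is the theorem multiplied by $\xi^{\mathbf k}$ or $z^{\mathbf k}$; the factor is
  a unit among the Laurent polynomials, where it is divided out.
\<close>

section \<open>Scalars, monomials and their products\<close>

lemma monomial_induct [case_names single add]:
  fixes p :: "'a \<Rightarrow>\<^sub>0 complex"
  assumes single: "\<And>m c. P (Poly_Mapping.single m c)"
    and add: "\<And>f g. P f \<Longrightarrow> P g \<Longrightarrow> P (f + g)"
  shows "P p"
proof -
  have "P 0" using single[of _ 0] by simp
  then have "P (\<Sum>m\<in>A. Poly_Mapping.single m (Poly_Mapping.lookup p m))" for A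
    by (induction A rule: infinite_finite_induct) (auto intro: single add)
  then have "P (lin_ext (\<lambda>m. Poly_Mapping.single m 1) p)"
    by (simp add: lin_ext_def scale_single)
  then show ?thesis by (simp add: lin_ext_id)
qed

text \<open>
  Writing scalar multiplication as multiplication by a constant polynomial lets the ring laws move
  scalars through products and sums.
\<close>

lemma scale_eq_mult: "scale c (p :: 'a::monoid_add \<Rightarrow>\<^sub>0 complex) = Poly_Mapping.single 0 c * p"
proof (induction p rule: monomial_induct)
  case (single m d)
  show ?case by (simp add: scale_single mult_single)
next
  case (add f g)
  have "scale c (f + g) = scale c f + scale c g"
    by (rule poly_mapping_eqI) (simp add: lookup_add algebra_simps)
  with add show ?case by (simp add: algebra_simps)
qed

lemma prod_single:
  "(\<Prod>i\<in>A. Poly_Mapping.single (m i) (c i)) =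
     Poly_Mapping.single (\<Sum>i\<in>A. m i :: 'a::comm_monoid_add) (\<Prod>i\<in>A. c i :: complex)"
  by (induction A rule: infinite_finite_induct) (simp_all add: mult_single flip: single_one)

lemma prod_scale:
  "(\<Prod>i\<in>A. scale (c i) (p i :: 'a::comm_monoid_add \<Rightarrow>\<^sub>0 complex)) = scale (\<Prod>i\<in>A. c i) (\<Prod>i\<in>A. p i)"
  by (simp add: scale_eq_mult prod.distrib prod_single)

definition exponent :: "('n \<Rightarrow> 'n var) \<Rightarrow> ('n::finite \<Rightarrow> nat) \<Rightarrow> 'n var \<Rightarrow>\<^sub>0 nat" where
  "exponent v a = (\<Sum>i\<in>UNIV. Poly_Mapping.single (v i) (a i))"

lemma lookup_exponent [simp]:
  "Poly_Mapping.lookup (exponent Xi a) (Xi i) = a i"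
  "Poly_Mapping.lookup (exponent Xi a) (Zv i) = 0"
  "Poly_Mapping.lookup (exponent Zv a) (Zv i) = a i"
  "Poly_Mapping.lookup (exponent Zv a) (Xi i) = 0"
  by (simp_all add: exponent_def lookup_sum lookup_single when_def)

lemma exponent_minus_single:
  "exponent Xi a - Poly_Mapping.single (Xi i) 1 = exponent Xi (a(i := a i - 1))"
  "exponent Zv a - Poly_Mapping.single (Zv i) 1 = exponent Zv (a(i := a i - 1))"
  by (rule poly_mapping_eqI, rename_tac w, case_tac w,
      simp_all add: lookup_minus lookup_single when_def)+

lemma indet_power: "indet v ^ n = Poly_Mapping.single (Poly_Mapping.single v n) 1"
  by (induction n)
    (simp_all add: indet_def mult_single flip: single_one single_add)

lemma var_power_eq_single: "var_power v a = Poly_Mapping.single (exponent v a) 1"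
  by (simp add: var_power_def indet_power prod_single exponent_def)

section \<open>The powers of $\Omega$ on monomials\<close>

lemma tensor_map_partial_single:
  "tensor_map (partial v) (partial w) (Poly_Mapping.single (a, b) c) =
     Poly_Mapping.single (a - Poly_Mapping.single v 1, b - Poly_Mapping.single w 1)
       (c * of_nat (Poly_Mapping.lookup a v) * of_nat (Poly_Mapping.lookup b w))"
  by (simp add: tensor_map_def partial_def scale_single mult.assoc)

lemma Omega_sum: "Omega (\<Sum>x\<in>A. f x) = (\<Sum>x\<in>A. Omega (f x))"
  by (simp add: Omega_def tensor_map_def lin_ext_sum sum.distrib sum.swap[of _ A])

lemma Omega_scale: "Omega (scale c t) = scale c (Omega t)"
  by (simp add: Omega_def tensor_map_def lin_ext_scale scale_sum)
    (simp add: scale_eq_mult algebra_simps)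

lemma Omega_xi_z:
  "Omega (Poly_Mapping.single (exponent Xi a, exponent Zv b) c) =
     (\<Sum>i\<in>UNIV. Poly_Mapping.single (exponent Xi (a(i := a i - 1)), exponent Zv (b(i := b i - 1)))
        (c * of_nat (a i) * of_nat (b i)))"
  by (simp add: Omega_def tensor_map_partial_single exponent_minus_single[simplified])

text \<open>
  The tensor $v_j$: it is
  $\frac{1}{j!} \prod_i (\delta_i \otimes \partial_i)^{j_i} (\xi^a \otimes z^b)$.  The falling
  factorials produced by the derivatives are written with binomial coefficients, so that $v_j = 0$
  as soon as one of the subtractions of exponents is truncated.
\<close>

definition contraction :: "('n::finite \<Rightarrow> nat) \<Rightarrow> ('n \<Rightarrow> nat) \<Rightarrow> ('n \<Rightarrow> nat) \<Rightarrow> 'n tensor_sq" where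
  "contraction a b j =
     Poly_Mapping.single (exponent Xi (\<lambda>i. a i - j i), exponent Zv (\<lambda>i. b i - j i))
       (\<Prod>i\<in>UNIV. fact (j i) * of_nat (a i choose j i) * of_nat (b i choose j i))"

lemma contraction_eq_0:
  assumes "a i < j i \<or> b i < j i"
  shows "contraction a b j = 0"
proof -
  have "(\<Prod>i\<in>UNIV. fact (j i) * of_nat (a i choose j i) * of_nat (b i choose j i)) = (0::complex)"
    using assms by (intro prod_zero) (auto simp: binomial_eq_0 intro!: bexI[of _ i])
  then show ?thesis unfolding contraction_def by (simp only: single_zero)
qed

text \<open>
  One more contraction in a single pair of variables: each factor $n - j$ coming from a derivative is
  absorbed by $(n - j) \binom{n}{j} = (j + 1) \binom{n}{j + 1}$, and of the two factors $j + 1$ so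
  gained one turns $j!$ into $(j + 1)!$.
\<close>

lemma binomial_step:
  "fact j * of_nat (a choose j) * of_nat (b choose j) * of_nat (a - j) * of_nat (b - j) =
     of_nat (Suc j) * (fact (Suc j) * of_nat (a choose Suc j) * of_nat (b choose Suc j) :: complex)"
proof -
  have *: "of_nat (n choose j) * of_nat (n - j) = of_nat (Suc j) * (of_nat (n choose Suc j) :: complex)" for n
    by (metis binomial_absorb_comp binomial_absorption diff_Suc_1 mult.commute of_nat_mult)
  have "fact j * of_nat (a choose j) * of_nat (b choose j) * of_nat (a - j) * of_nat (b - j) =
     (fact j :: complex) * (of_nat (a choose j) * of_nat (a - j)) * (of_nat (b choose j) * of_nat (b - j))"
    by (simp only: mult_ac)
  also have "\<dots> = of_nat (Suc j) * (fact (Suc j) * of_nat (a choose Suc j) * of_nat (b choose Suc j))"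
    unfolding * fact_Suc by (simp only: mult_ac)
  finally show ?thesis .
qed

lemma Omega_contraction:
  "Omega (contraction a b j) =
     (\<Sum>i\<in>UNIV. scale (of_nat (Suc (j i))) (contraction a b (j(i := Suc (j i)))))"
  unfolding contraction_def Omega_xi_z scale_single
proof (intro sum.cong refl arg_cong2[where f = Poly_Mapping.single] arg_cong2[where f = Pair]
    arg_cong2[where f = exponent])
  fix i
  define c :: "'a \<Rightarrow> nat \<Rightarrow> complex"
    where "c l m = fact m * of_nat (a l choose m) * of_nat (b l choose m)" for l m
  have rest: "(\<Prod>l\<in>UNIV - {i}. c l ((j(i := Suc (j i))) l)) = (\<Prod>l\<in>UNIV - {i}. c l (j l))"
    by (intro prod.cong) auto
  have "(\<Prod>l\<in>UNIV. c l (j l)) * of_nat (a i - j i) * of_nat (b i - j i) =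
      (\<Prod>l\<in>UNIV - {i}. c l (j l)) * (c i (j i) * of_nat (a i - j i) * of_nat (b i - j i))"
    by (simp add: prod.remove[of UNIV i] mult_ac)
  also have "c i (j i) * of_nat (a i - j i) * of_nat (b i - j i) = of_nat (Suc (j i)) * c i (Suc (j i))"
    unfolding c_def by (rule binomial_step)
  also have "(\<Prod>l\<in>UNIV - {i}. c l (j l)) * (of_nat (Suc (j i)) * c i (Suc (j i))) =
      of_nat (Suc (j i)) * (\<Prod>l\<in>UNIV. c l ((j(i := Suc (j i))) l))"
    by (subst prod.remove[of UNIV i]) (simp_all only: rest finite UNIV_I fun_upd_same mult_ac)
  finally show "(\<Prod>l\<in>UNIV. fact (j l) * of_nat (a l choose j l) * of_nat (b l choose j l)) *
      of_nat (a i - j i) * of_nat (b i - j i) =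
    of_nat (Suc (j i)) * (\<Prod>l\<in>UNIV. fact ((j(i := Suc (j i))) l) *
      of_nat (a l choose (j(i := Suc (j i))) l) * (of_nat (b l choose (j(i := Suc (j i))) l) :: complex))"
    unfolding c_def .
qed auto

text \<open>
  The multi-indices of the possibly nonzero $v_j$, written as a finite function space so that a
  product of sums expands over it.
\<close>

definition contractions :: "('n::finite \<Rightarrow> nat) \<Rightarrow> ('n \<Rightarrow> nat) \<Rightarrow> ('n \<Rightarrow> nat) set" where
  "contractions a b = (\<Pi>\<^sub>E i\<in>UNIV. {..min (a i) (b i)})"

lemma mem_contractions: "j \<in> contractions a b \<longleftrightarrow> (\<forall>i. j i \<le> a i \<and> j i \<le> b i)"
  by (auto simp: contractions_def PiE_def Pi_def)

lemma finite_contractions [simp]: "finite (contractions a b)"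
  by (simp add: contractions_def finite_PiE)

definition contraction_sum :: "('n::finite \<Rightarrow> nat) \<Rightarrow> ('n \<Rightarrow> nat) \<Rightarrow> nat \<Rightarrow> 'n tensor_sq" where
  "contraction_sum a b n = (\<Sum>j | j \<in> contractions a b \<and> multi_size j = n. contraction a b j)"

lemma multi_size_upd_Suc: "multi_size (j(i := Suc (j i))) = Suc (multi_size j)"
proof -
  have "multi_size (j(i := Suc (j i))) = Suc (j i) + (\<Sum>l\<in>UNIV - {i}. j l)"
    by (simp add: multi_size_def sum.remove[of UNIV i])
  then show ?thesis by (simp add: multi_size_def sum.remove[of UNIV i])
qed

lemma multi_size_upd_pred: "j i \<noteq> 0 \<Longrightarrow> Suc (multi_size (j(i := j i - 1))) = multi_size j"
  using multi_size_upd_Suc[of "j(i := j i - 1)" i] by simp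

text \<open>
  For each fixed $i$ the map $j \mapsto j + e_i$ reindexes the sum over $|j| = n$ to one over
  $|j| = n + 1$.  It is a bijection only up to terms that vanish: it leaves the index set when $j_i$
  is already maximal, where $v_{j + e_i} = 0$, and it misses the $j$ with $j_i = 0$, whose weight
  $j_i$ is zero.
\<close>

lemma Omega_contraction_sum:
  "Omega (contraction_sum a b n) = scale (of_nat (Suc n)) (contraction_sum a b (Suc n))"
proof -
  let ?J = "\<lambda>n. {j. j \<in> contractions a b \<and> multi_size j = n}"
  have shift: "(\<Sum>j\<in>?J n. scale (of_nat (Suc (j i))) (contraction a b (j(i := Suc (j i))))) =
      (\<Sum>j\<in>?J (Suc n). scale (of_nat (j i)) (contraction a b j))" for i
  proof (rule sum.reindex_bij_witness_not_neutral
      [where S' = "{j \<in> ?J n. j i = a i \<or> j i = b i}" and T' = "{j \<in> ?J (Suc n). j i = 0}"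
        and i = "\<lambda>j. j(i := j i - 1)" and j = "\<lambda>j. j(i := Suc (j i))"], goal_cases)
    case (4 j) then show ?case
      by (auto simp: mem_contractions multi_size_upd_Suc Suc_le_eq order.strict_iff_order)
  next
    case (6 j)
    then have "j i \<noteq> 0" by simp
    from 6 have "j i \<le> a i" "j i \<le> b i" by (simp_all add: mem_contractions)
    with \<open>j i \<noteq> 0\<close> have "j i - 1 \<noteq> a i" "j i - 1 \<noteq> b i" by simp_all
    with 6 \<open>j i \<noteq> 0\<close> show ?case
      using multi_size_upd_pred[of j i]
      by (auto simp: mem_contractions intro: le_trans[OF diff_le_self])
  qed (auto simp: contraction_eq_0[of a i _ b])
  have "Omega (contraction_sum a b n) =
      (\<Sum>i\<in>UNIV. \<Sum>j\<in>?J n. scale (of_nat (Suc (j i))) (contraction a b (j(i := Suc (j i)))))"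
    unfolding contraction_sum_def Omega_sum Omega_contraction by (rule sum.swap)
  also have "\<dots> = (\<Sum>j\<in>?J (Suc n). \<Sum>i\<in>UNIV. scale (of_nat (j i)) (contraction a b j))"
    unfolding shift by (rule sum.swap)
  also have "\<dots> = (\<Sum>j\<in>?J (Suc n). scale (of_nat (multi_size j)) (contraction a b j))"
    by (intro sum.cong refl poly_mapping_eqI)
      (simp only: multi_size_def lookup_sum lookup_scale of_nat_sum sum_distrib_right)
  also have "\<dots> = scale (of_nat (Suc n)) (contraction_sum a b (Suc n))"
    unfolding contraction_sum_def scale_sum by (intro sum.cong) auto
  finally show ?thesis .
qed

section \<open>The product of a monomial in $\xi$ and a monomial in $z$\<close>

lemma contraction_sum_0: "contraction_sum a b 0 = contraction a b (\<lambda>_. 0)"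
proof -
  have "{j. j \<in> contractions a b \<and> multi_size j = 0} = {\<lambda>_. 0}"
    by (auto simp: mem_contractions multi_size_def)
  then show ?thesis by (simp add: contraction_sum_def)
qed

lemma neg_Omega_power:
  "((\<lambda>t. - Omega t) ^^ n) (contraction a b (\<lambda>_. 0)) =
     scale ((-1) ^ n * fact n) (contraction_sum a b n)"
proof (induction n)
  case 0
  show ?case by (simp add: contraction_sum_0)
next
  case (Suc n)
  have "- p = scale (-1) p" for p :: "'a tensor_sq"
    by (rule poly_mapping_eqI) simp
  with Suc show ?case
    by (simp add: Omega_scale Omega_contraction_sum scale_scale algebra_simps)
qed

text \<open>
  The factor $n!$ in the $n$-th power of $\Omega$ cancels the one in the exponential series, and the
  sums over $|j| = n$ for all $n$ combine to one sum over all $j$.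
\<close>

lemma star_eq_sum_contractions:
  "var_power Xi a \<star> var_power Zv b =
     mu (\<Sum>j\<in>contractions a b. scale ((-1) ^ multi_size j) (contraction a b j))"
proof -
  let ?g = "\<lambda>n. scale ((-1) ^ n) (contraction_sum a b n)"
  have start: "tensor (var_power Xi a) (var_power Zv b) = contraction a b (\<lambda>_. 0)"
    by (simp add: var_power_eq_single contraction_def)
  have "op_exp (\<lambda>t. - Omega t) (contraction a b (\<lambda>_. 0)) = Sum_any ?g"
    by (simp add: op_exp_def neg_Omega_power scale_scale)
  also have "\<dots> = (\<Sum>n\<in>multi_size ` contractions a b. ?g n)"
  proof (rule Sum_any.expand_superset)
    have "?g n = 0" if "n \<notin> multi_size ` contractions a b" for n
    proof -
      from that have "{j. j \<in> contractions a b \<and> multi_size j = n} = {}" by auto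
      then show ?thesis unfolding contraction_sum_def by (simp only: sum.empty scale_simps)
    qed
    then show "{n. ?g n \<noteq> 0} \<subseteq> multi_size ` contractions a b" by blast
  qed simp
  also have "\<dots> = (\<Sum>n\<in>multi_size ` contractions a b.
      \<Sum>j | j \<in> contractions a b \<and> multi_size j = n. scale ((-1) ^ multi_size j) (contraction a b j))"
    unfolding contraction_sum_def scale_sum by (intro sum.cong) auto
  also have "\<dots> = (\<Sum>j\<in>contractions a b. scale ((-1) ^ multi_size j) (contraction a b j))"
    by (intro sum.group) auto
  finally show ?thesis by (simp add: star_prod_def start)
qed

lemma mu_contraction:
  "mu (scale ((-1) ^ multi_size j) (contraction a b j)) =
     (\<Prod>i\<in>UNIV. scale ((-1) ^ j i * fact (j i) * of_nat (a i choose j i) * of_nat (b i choose j i))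
        (indet (Xi i) ^ (a i - j i) * indet (Zv i) ^ (b i - j i)))"
  by (simp add: contraction_def scale_single mu_def exponent_def indet_power mult_single prod_single
      multi_size_def power_sum sum.distrib mult.assoc flip: prod.distrib)

text \<open>
  The coefficients and monomials are products over $i$ of terms depending only on $j_i$, and the
  $j_i$ range independently, so the sum over $j$ is the expansion of a product of sums.
\<close>

lemma star_xi_z:
  "var_power Xi a \<star> var_power Zv b =
     (\<Prod>i\<in>UNIV. \<Sum>l\<le>min (a i) (b i).
        scale ((-1) ^ l * fact l * of_nat (a i choose l) * of_nat (b i choose l))
          (indet (Xi i) ^ (a i - l) * indet (Zv i) ^ (b i - l)))"
proof -
  have "var_power Xi a \<star> var_power Zv b =
      (\<Sum>j\<in>contractions a b. mu (scale ((-1) ^ multi_size j) (contraction a b j)))"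
    unfolding star_eq_sum_contractions by (simp add: mu_def lin_ext_sum)
  also have "\<dots> = (\<Prod>i\<in>UNIV. \<Sum>l\<le>min (a i) (b i).
        scale ((-1) ^ l * fact l * of_nat (a i choose l) * of_nat (b i choose l))
          (indet (Xi i) ^ (a i - l) * indet (Zv i) ^ (b i - l)))"
    unfolding mu_contraction contractions_def by (subst prod_sum_PiE) auto
  finally show ?thesis .
qed

section \<open>Comparison with the Laguerre polynomials\<close>

lemma coeff_laguerre:
  "coeff (laguerre k m) j = (if j \<le> m then of_nat ((m + k) choose (m - j)) * (-1) ^ j / fact j else 0)"
proof -
  have "[:0, -1:] ^ i = monom ((-1) ^ i :: complex) i" for i :: nat
    by (induction i) (simp_all add: monom_0 monom_Suc one_pCons smult_monom)
  then show ?thesis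
    by (simp add: laguerre_def coeff_sum if_distrib sum.delta cong: if_cong)
qed

lemma poly_laguerre:
  fixes x :: "'n cpoly"
  shows "poly (map_poly (Poly_Mapping.single 0) (laguerre k m)) x =
     (\<Sum>j\<le>m. scale (of_nat ((m + k) choose (m - j)) * (-1) ^ j / fact j) (x ^ j))"
proof -
  let ?p = "map_poly (Poly_Mapping.single 0) (laguerre k m) :: 'n cpoly poly"
  have coeff: "coeff ?p j = Poly_Mapping.single 0 (coeff (laguerre k m) j)" for j
    by (simp add: coeff_map_poly)
  have "degree ?p \<le> m"
    by (rule degree_le) (simp add: coeff coeff_laguerre)
  then have "poly ?p x = (\<Sum>j\<le>m. coeff ?p j * x ^ j)"
    unfolding poly_altdef by (intro sum.mono_neutral_left) (auto simp: coeff_eq_0)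
  then show ?thesis
    by (simp add: coeff coeff_laguerre scale_eq_mult)
qed

text \<open>
  Reversing the sum by $l = m - j$ matches both sides term by term: in degree $j$,
  \[
    \frac{(-1)^m}{m!} (-1)^l\, l! \binom{m + k}{l} \binom{m}{l}
      = \binom{m + k}{m - j} \frac{(-1)^j}{j!} ,
  \]
  since $\binom{m}{l}\, l! / m! = 1 / j!$.
\<close>

lemma laguerre_one_variable:
  fixes x y :: "'n cpoly"
  shows "x ^ k * poly (map_poly (Poly_Mapping.single 0) (laguerre k m)) (x * y) =
    scale ((-1) ^ m / fact m)
      (\<Sum>l\<le>m. scale ((-1) ^ l * fact l * of_nat ((m + k) choose l) * of_nat (m choose l))
         (x ^ (m + k - l) * y ^ (m - l)))"
proof -
  have "x ^ k * poly (map_poly (Poly_Mapping.single 0) (laguerre k m)) (x * y) =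
     (\<Sum>j\<le>m. scale (of_nat ((m + k) choose (m - j)) * (-1) ^ j / fact j) (x ^ (k + j) * y ^ j))"
    by (simp add: poly_laguerre sum_distrib_left scale_eq_mult power_mult_distrib power_add mult_ac)
  also have "\<dots> = (\<Sum>l\<le>m. scale ((-1) ^ m / fact m *
      ((-1) ^ l * fact l * of_nat ((m + k) choose l) * of_nat (m choose l)))
         (x ^ (m + k - l) * y ^ (m - l)))"
  proof (rule sum.reindex_bij_witness[where i = "\<lambda>l. m - l" and j = "\<lambda>j. m - j"], goal_cases)
    case (5 j)
    then have "j \<le> m" by simp
    then obtain l where m: "m = j + l" using le_Suc_ex by blast
    have "of_nat (m choose l) = (fact m / (fact l * fact j) :: complex)"
      by (simp add: m binomial_fact)
    then have "(-1) ^ m / fact m *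
        ((-1) ^ l * fact l * of_nat ((m + k) choose l) * of_nat (m choose l)) =
        ((-1) ^ m * (-1) ^ l) * of_nat ((m + k) choose l) / (fact j :: complex)"
      by simp
    also have "(-1) ^ m * (-1) ^ l = ((-1) ^ j :: complex)"
      by (simp add: m power_add mult.assoc flip: power_mult_distrib)
    finally show ?case
      by (simp add: m add_ac mult_ac)
  qed auto
  finally show ?thesis by (simp add: scale_sum scale_scale)
qed

lemma xi_power_mlaguerre:
  "var_power Xi k * mlaguerre k \<alpha> (\<lambda>i. indet (Xi i) * indet (Zv i)) =
     scale ((-1) ^ multi_size \<alpha> / multi_fact \<alpha>)
       (var_power Xi (\<lambda>i. \<alpha> i + k i) \<star> var_power Zv \<alpha>)"
  unfolding star_xi_z
  by (simp add: var_power_def mlaguerre_def laguerre_one_variable prod_scale multi_size_def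
      multi_fact_def power_sum prod_dividef flip: prod.distrib)

text \<open>
  The roles of $\xi$ and $z$ can be exchanged because the coefficients in the formula for
  $\xi^a \ast z^b$ are symmetric in $a$ and $b$.
\<close>

lemma z_power_mlaguerre:
  "var_power Zv k * mlaguerre k \<alpha> (\<lambda>i. indet (Xi i) * indet (Zv i)) =
     scale ((-1) ^ multi_size \<alpha> / multi_fact \<alpha>)
       (var_power Xi \<alpha> \<star> var_power Zv (\<lambda>i. \<alpha> i + k i))"
proof -
  have *: "indet (Zv i) ^ k i * poly (map_poly (Poly_Mapping.single 0) (laguerre (k i) (\<alpha> i)))
        (indet (Xi i) * indet (Zv i)) =
      scale ((-1) ^ \<alpha> i / fact (\<alpha> i))
      (\<Sum>l\<le>min (\<alpha> i) (\<alpha> i + k i).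
        scale ((-1) ^ l * fact l * of_nat (\<alpha> i choose l) * of_nat ((\<alpha> i + k i) choose l))
         (indet (Xi i) ^ (\<alpha> i - l) * indet (Zv i) ^ (\<alpha> i + k i - l)))" for i
    using laguerre_one_variable[of "indet (Zv i)" "k i" "\<alpha> i" "indet (Xi i)"]
    by (simp add: mult_ac)
  show ?thesis
    unfolding star_xi_z
    by (simp only: var_power_def mlaguerre_def * prod_scale multi_size_def
      multi_fact_def power_sum prod_dividef flip: prod.distrib)
qed

section \<open>Division by monomials in the Laurent polynomials\<close>

lemma to_laurent_monomial_mult:
  "to_laurent (Poly_Mapping.single m 1 * p) =
     Poly_Mapping.single (Poly_Mapping.map int m) 1 * to_laurent p"
proof (induction p rule: monomial_induct)
  case (single m' c)
  have "Poly_Mapping.map int (m + m') = Poly_Mapping.map int m + Poly_Mapping.map int m'"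
    by (rule poly_mapping_eqI) (simp add: lookup_add Poly_Mapping.map.rep_eq when_def)
  then show ?case by (simp add: mult_single to_laurent_single)
next
  case (add f g)
  then show ?case
    unfolding to_laurent_def by (simp add: lin_ext_add algebra_simps)
qed

lemma laurent_monom_cancel:
  "laurent_monom v (\<lambda>i. - int (k i)) * to_laurent (var_power v k * p) = to_laurent p"
proof -
  have "Poly_Mapping.map int (\<Sum>i\<in>A. Poly_Mapping.single (v i) (k i)) =
      (\<Sum>i\<in>A. Poly_Mapping.single (v i) (int (k i)))" for A
    by (rule poly_mapping_eqI)
      (auto simp: lookup_sum Poly_Mapping.map.rep_eq when_def lookup_single intro!: sum.neutral sum.cong)
  then have "laurent_monom v (\<lambda>i. - int (k i)) *
      Poly_Mapping.single (Poly_Mapping.map int (exponent v k)) 1 = 1"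
    by (simp add: laurent_monom_def exponent_def mult_single single_uminus
        flip: sum.distrib single_add)
  then show ?thesis
    by (simp add: var_power_eq_single to_laurent_monomial_mult flip: mult.assoc)
qed

lemma laurent_monom_quotient:
  assumes "var_power v k * p = scale c q"
  shows "to_laurent p = scale c (laurent_monom v (\<lambda>i. - int (k i)) * to_laurent q)"
proof -
  have "to_laurent p = laurent_monom v (\<lambda>i. - int (k i)) * to_laurent (scale c q)"
    by (simp add: laurent_monom_cancel flip: assms)
  also have "to_laurent (scale c q) = scale c (to_laurent q)"
    by (simp add: to_laurent_def lin_ext_scale)
  finally show ?thesis
    by (simp add: scale_eq_mult mult_ac)
qed

theorem theorem5p2:
  fixes k \<alpha> :: "'n::finite \<Rightarrow> nat"
  shows "to_laurent (mlaguerre k \<alpha> (\<lambda>i. indet (Xi i) * indet (Zv i)))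
           = scale ((-1) ^ multi_size \<alpha> / multi_fact \<alpha>)
               (laurent_monom Xi (\<lambda>i. - int (k i))
                 * to_laurent (var_power Xi (\<lambda>i. \<alpha> i + k i) \<star> var_power Zv \<alpha>))
       \<and> to_laurent (mlaguerre k \<alpha> (\<lambda>i. indet (Xi i) * indet (Zv i)))
           = scale ((-1) ^ multi_size \<alpha> / multi_fact \<alpha>)
               (laurent_monom Zv (\<lambda>i. - int (k i))
                 * to_laurent (var_power Xi \<alpha> \<star> var_power Zv (\<lambda>i. \<alpha> i + k i)))
       \<and> mlaguerre0 \<alpha> (\<lambda>i. indet (Xi i) * indet (Zv i))
           = scale ((-1) ^ multi_size \<alpha> / multi_fact \<alpha>) (var_power Xi \<alpha> \<star> var_power Zv \<alpha>)"
  using xi_power_mlaguerre[of "\<lambda>_. 0" \<alpha>]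
  by (intro conjI laurent_monom_quotient xi_power_mlaguerre z_power_mlaguerre)
    (simp add: var_power_def)

end
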